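(* Let $\mathcal{H}$ be a real Hilbert space and let $f,g\colon\mathcal{H}\to\left]-\infty,+\infty\right]$ be proper convex lower semicontinuous functions with $\operatorname{dom} g\subset\operatorname{dom} f$ and $f$ Gâteaux differentiable on $\operatorname{dom}g$. Let $k\in\mathbb{N}$, $\gamma_k\in\left]0,+\infty\right[$, $\lambda_k\in\left]0,1\right]$, $x_k\in\operatorname{dom}g$, and set $y_k=\operatorname{prox}_{\gamma_kg}(x_k-\gamma_k\nabla f(x_k))$ and $x_{k+1}=x_k+\lambda_k(y_k-x_k)$. Let $\delta\in\left]0,1\right[$ and consider the following statements: (a) $\displaystyle\|\nabla f(x_{k+1})-\nabla f(x_k)\|\le\frac{\delta}{\gamma_k\lambda_k}\|x_{k+1}-x_k\|$. (b) $\displaystyle f(x_{k+1})-f(x_k)-\langle x_{k+1}-x_k\mid\nabla f(x_k)\rangle\le\frac{\delta}{\gamma_k\lambda_k}\|x_{k+1}-x_k\|^2$. (c) $(f+g)(x_{k+1})-(f+g)(x_k)\le(1-\delta)\lambda_k\big(g(y_k)-g(x_k)+\langle y_k-x_k\mid\nabla f(x_k)\rangle\big)$. Then the following hold. (i) (a) $\Rightarrow$ (b) $\Rightarrow$ (c). (ii) If (c) holds, then, for every $x\in\operatorname{dom}g$, $$\|x_{k+1}-x\|^2\le\|x_k-x\|^2+2\gamma_k\lambda_k\big((f+g)(x)-(f+g)(x_k)\big)+\frac{2\gamma_k}{1-\delta}\big((f+g)(x_k)-(f+g)(x_{k+1})\big)-\|x_{k+1}-x_k\|^2.$$ (iii)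 If (c) holds, then $$(1-\delta)\|x_{k+1}-x_k\|^2\le\gamma_k\big((f+g)(x_k)-(f+g)(x_{k+1})\big);$$ in particular $(f+g)(x_{k+1})\le(f+g)(x_k)$.
   Context: $\mathcal{H}$ has scalar product $\langle\cdot\mid\cdot\rangle$ and norm $\|\cdot\|$. A proper convex function $h$ is Gâteaux differentiable at $x\in\operatorname{dom}h$ if there is $u\in\mathcal{H}$ with $\lim_{t\to0}(h(x+td)-h(x))/t=\langle d\mid u\rangle$ for all $d\in\mathcal{H}$; then $\nabla h(x):=u$. For $h$ proper convex lower semicontinuous, $\operatorname{prox}_h(x)=\operatorname{argmin}_{y\in\mathcal{H}}\big(h(y)+\tfrac12\|y-x\|^2\big)$. *)

theory Defs
  imports "HOL-Analysis.Analysis"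
begin

text \<open>
  Functions with values in \<open>]-\<infinity>, +\<infinity>]\<close> are modelled as \<^typ>\<open>ereal\<close>-valued functions;
  the value \<open>-\<infinity>\<close> is excluded by \<open>proper\<close>.
\<close>

definition eff_dom :: "('a \<Rightarrow> ereal) \<Rightarrow> 'a set" where
  "eff_dom h = {x. h x < \<infinity>}"

definition proper :: "('a \<Rightarrow> ereal) \<Rightarrow> bool" where
  "proper h \<longleftrightarrow> (\<forall>x. h x \<noteq> -\<infinity>) \<and> eff_dom h \<noteq> {}"

text \<open>
  The weights are taken strictly between 0 and 1, so that the convention \<open>0 * \<infinity> = 0\<close> plays no
  role.
\<close>

definition convex_fun :: "('a::real_vector \<Rightarrow> ereal) \<Rightarrow> bool" where
  "convex_fun h \<longleftrightarrow> (\<forall>x y. \<forall>t\<in>{0<..<1}.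
     h (t *\<^sub>R x + (1 - t) *\<^sub>R y) \<le> ereal t * h x + ereal (1 - t) * h y)"

definition lower_semicont :: "('a::topological_space \<Rightarrow> ereal) \<Rightarrow> bool" where
  "lower_semicont h \<longleftrightarrow> (\<forall>x. h x \<le> Liminf (at x) h)"

text \<open>
  At a point of the effective domain the difference quotient is well defined in the extended
  reals, even if \<open>h (x + t *\<^sub>R d) = \<infinity>\<close>. Its limit is taken over both signs of \<open>t\<close>.
\<close>

definition has_gateaux_gradient ::
    "('a::real_inner \<Rightarrow> ereal) \<Rightarrow> 'a \<Rightarrow> 'a \<Rightarrow> bool" where
  "has_gateaux_gradient h u x \<longleftrightarrow> x \<in> eff_dom h \<and>
     (\<forall>d. ((\<lambda>t. (h (x + t *\<^sub>R d) - h x) / ereal t) \<longlongrightarrow> ereal (d \<bullet> u)) (at 0))"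

definition gateaux_differentiable :: "('a::real_inner \<Rightarrow> ereal) \<Rightarrow> 'a \<Rightarrow> bool" where
  "gateaux_differentiable h x \<longleftrightarrow> (\<exists>u. has_gateaux_gradient h u x)"

definition gateaux_grad :: "('a::real_inner \<Rightarrow> ereal) \<Rightarrow> 'a \<Rightarrow> 'a" where
  "gateaux_grad h x = (THE u. has_gateaux_gradient h u x)"

text \<open>
  For proper convex lower semicontinuous \<open>h\<close> on a Hilbert space the minimizer exists and is
  unique, and \<^const>\<open>arg_min\<close> denotes it.
\<close>

definition prox :: "('a::real_inner \<Rightarrow> ereal) \<Rightarrow> 'a \<Rightarrow> 'a" where
  "prox h x = (ARG_MIN (\<lambda>y. h y + ereal (1 / 2 * (norm (y - x))\<^sup>2)) y. True)"

end

theory Submission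
  imports Defs
begin

text \<open>
  With \<open>u\<close> the gradient of \<open>f\<close> at \<open>x\<^sub>k\<close> and
  \<open>\<Delta> = g y\<^sub>k - g x\<^sub>k + (y\<^sub>k - x\<^sub>k) \<bullet> u\<close>, the variational inequality for the proximal point,
  \<open>(x\<^sub>k - \<gamma> u - y\<^sub>k) \<bullet> (z - y\<^sub>k) \<le> \<gamma> (g z - g y\<^sub>k)\<close> on the domain of \<open>g\<close>, gives
  \<open>\<parallel>y\<^sub>k - x\<^sub>k\<parallel>\<^sup>2 \<le> - \<gamma> \<Delta>\<close> at \<open>z = x\<^sub>k\<close>. All the claims follow from this inequality and the
  gradient inequality for \<open>f\<close> by expanding squares. The proximal point exists because a
  convex lower semicontinuous function decreases at most linearly, so that the proximal objective
  is bounded below, and because its minimizing sequences are Cauchy by the parallelogram law.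
\<close>

section \<open>Extended-real convex functions as real functions on their effective domain\<close>

lemma proper_eq_ereal:
  assumes "proper h" and "z \<in> eff_dom h"
  shows "h z = ereal (real_of_ereal (h z))"
  using assms by (cases "h z") (auto simp: proper_def eff_dom_def)

lemma convex_on_real_of_ereal:
  assumes "proper h" and "convex_fun h"
  shows "convex_on (eff_dom h) (\<lambda>z. real_of_ereal (h z))"
proof -
  have *: "a *\<^sub>R p + b *\<^sub>R q \<in> eff_dom h \<and>
      real_of_ereal (h (a *\<^sub>R p + b *\<^sub>R q)) \<le> a * real_of_ereal (h p) + b * real_of_ereal (h q)"
    if pq: "p \<in> eff_dom h" "q \<in> eff_dom h" and ab: "0 < a" "0 < b" "a + b = 1" for p q a b
  proof -
    have "h (a *\<^sub>R p + (1 - a) *\<^sub>R q) \<le> ereal a * h p + ereal (1 - a) * h q"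
      using \<open>convex_fun h\<close> ab unfolding convex_fun_def by auto
    also have "1 - a = b"
      using ab by simp
    also have "ereal a * h p + ereal b * h q
        = ereal (a * real_of_ereal (h p) + b * real_of_ereal (h q))"
      using proper_eq_ereal[OF \<open>proper h\<close> pq(1)] proper_eq_ereal[OF \<open>proper h\<close> pq(2)]
      by (metis plus_ereal.simps(1) times_ereal.simps(1))
    finally have le: "h (a *\<^sub>R p + b *\<^sub>R q)
        \<le> ereal (a * real_of_ereal (h p) + b * real_of_ereal (h q))" .
    then have dom: "a *\<^sub>R p + b *\<^sub>R q \<in> eff_dom h"
      unfolding eff_dom_def using le_less_trans by fastforce
    with le show ?thesis
      using proper_eq_ereal[OF \<open>proper h\<close> dom] by (metis ereal_less_eq(3))
  qed
  have "convex (eff_dom h)"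
    unfolding convex_alt
  proof (intro ballI allI impI)
    fix p q u assume "p \<in> eff_dom h" "q \<in> eff_dom h" and "0 \<le> (u::real) \<and> u \<le> 1"
    \<comment> \<open>\<open>convex_fun\<close> only covers weights strictly between 0 and 1; the
      two end weights return \<open>p\<close> and \<open>q\<close> themselves.\<close>
    then show "(1 - u) *\<^sub>R p + u *\<^sub>R q \<in> eff_dom h"
      using *[of p q "1 - u" u] by (cases "u = 0"; cases "u = 1") auto
  qed
  then show ?thesis
    using * by (intro convex_onI) auto
qed

lemma lower_semicont_closed_sublevel:
  fixes h :: "'a::metric_space \<Rightarrow> ereal"
  assumes "lower_semicont h"
  shows "closed {z. h z \<le> c}"
proof -
  have "open {z. c < h z}"
    unfolding open_dist
  proof (intro ballI)
    fix z assume "z \<in> {z. c < h z}"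
    then have z: "c < h z" by simp
    have "h z \<le> Liminf (at z) h"
      using assms unfolding lower_semicont_def by blast
    with z have "eventually (\<lambda>v. c < h v) (at z)"
      unfolding le_Liminf_iff by blast
    then obtain d where "0 < d" "\<And>v. v \<noteq> z \<Longrightarrow> dist v z < d \<Longrightarrow> c < h v"
      unfolding eventually_at by auto
    \<comment> \<open>The limit inferior along \<open>at z\<close> ignores the centre of the ball,
      which is supplied by \<open>c < h z\<close>.\<close>
    with z show "\<exists>e>0. \<forall>v. dist v z < e \<longrightarrow> v \<in> {z. c < h z}"
      by (metis mem_Collect_eq)
  qed
  moreover have "- {z. h z \<le> c} = {z. c < h z}"
    by auto
  ultimately show ?thesis
    by (simp add: closed_def)
qed

text \<open>The sets are closed in the whole space, not just relative to the domain. In this form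
  lower semicontinuity keeps limits of minimizing sequences inside the domain.\<close>

lemma closed_sublevel_real_of_ereal:
  fixes h :: "'a::metric_space \<Rightarrow> ereal"
  assumes "proper h" and "lower_semicont h"
  shows "closed {z \<in> eff_dom h. real_of_ereal (h z) \<le> c}"
proof -
  have "(h z \<le> ereal c) = (z \<in> eff_dom h \<and> real_of_ereal (h z) \<le> c)" for z
    using \<open>proper h\<close> by (cases "h z") (auto simp: proper_def eff_dom_def)
  then show ?thesis
    using lower_semicont_closed_sublevel[OF assms(2), of "ereal c"] by simp
qed

section \<open>Existence and characterization of the proximal point\<close>

text \<open>Closedness keeps \<open>G\<close> above \<open>G x - 1\<close> on a ball around
  \<open>x\<close>. A point outside the ball is joined to \<open>x\<close> by a segment crossing the
  sphere, and convexity carries the bound from the crossing point outwards.\<close>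

lemma convex_on_linear_minorant:
  fixes G :: "'a::real_normed_vector \<Rightarrow> real"
  assumes conv: "convex_on D G" and "x \<in> D" and "closed {z \<in> D. G z \<le> G x - 1}"
  obtains M where "0 \<le> M" and "\<And>z. z \<in> D \<Longrightarrow> G x - 1 - M * norm (z - x) \<le> G z"
proof -
  have "open (- {z \<in> D. G z \<le> G x - 1})" "x \<in> - {z \<in> D. G z \<le> G x - 1}"
    using assms by auto
  then obtain r where r: "0 < r" "cball x r \<subseteq> - {z \<in> D. G z \<le> G x - 1}"
    using open_contains_cball by blast
  have "G x - 1 - 1 / r * norm (z - x) \<le> G z" if "z \<in> D" for z
  proof (cases "norm (z - x) \<le> r")
    case True
    then have "z \<in> cball x r" by (simp add: dist_norm norm_minus_commute)
    then have "G x - 1 < G z" using r \<open>z \<in> D\<close> by auto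
    moreover have "0 \<le> 1 / r * norm (z - x)" using r by simp
    ultimately show ?thesis by linarith
  next
    case False
    define n where "n = norm (z - x)"
    \<comment> \<open>This weight puts \<open>p\<close> on the sphere of radius \<open>r\<close>.
      The loss of 1 there grows by the factor \<open>1 / t = n / r\<close> at \<open>z\<close>,
      hence the slope \<open>1 / r\<close>.\<close>
    define t where "t = r / n"
    have n: "r < n" "0 < n" using False r by (auto simp: n_def)
    have t: "0 < t" "t < 1" using r n by (auto simp: t_def)
    define p where "p = (1 - t) *\<^sub>R x + t *\<^sub>R z"
    have "p - x = t *\<^sub>R (z - x)" by (simp add: p_def algebra_simps)
    then have "norm (p - x) = r" using r n by (simp add: t_def n_def[symmetric])
    then have "p \<in> cball x r" by (simp add: dist_norm norm_minus_commute)
    moreover have "p \<in> D"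
      using convex_on_imp_convex[OF conv] \<open>x \<in> D\<close> \<open>z \<in> D\<close> t
      by (auto simp: p_def convex_alt)
    ultimately have "G x - 1 < G p" using r by auto
    also have "G p \<le> (1 - t) * G x + t * G z"
      unfolding p_def using t \<open>x \<in> D\<close> \<open>z \<in> D\<close> by (intro convex_onD[OF conv]) auto
    finally have "t * (G x - 1 / t) \<le> t * G z" using t by (simp add: algebra_simps)
    then have "G x - 1 / t \<le> G z" using t by simp
    moreover have "1 / t = 1 / r * n" using r n by (simp add: t_def)
    ultimately show ?thesis by (simp add: n_def)
  qed
  with r show ?thesis by (intro that[of "1 / r"]) auto
qed

lemma proximal_point_exists:
  fixes G :: "'a::{real_inner, complete_space} \<Rightarrow> real"
  assumes conv: "convex_on D G" and "D \<noteq> {}"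
    and closed: "\<And>c. closed {z \<in> D. G z \<le> c}"
  shows "\<exists>p\<in>D. \<forall>z\<in>D. G p + 1 / 2 * (norm (p - w))\<^sup>2 \<le> G z + 1 / 2 * (norm (z - w))\<^sup>2"
proof -
  define \<phi> where "\<phi> z = G z + 1 / 2 * (norm (z - w))\<^sup>2" for z
  obtain x where "x \<in> D" using \<open>D \<noteq> {}\<close> by blast
  then obtain M where M: "0 \<le> M" "\<And>z. z \<in> D \<Longrightarrow> G x - 1 - M * norm (z - x) \<le> G z"
    using convex_on_linear_minorant[OF conv _ closed] by metis
  \<comment> \<open>The quadratic term absorbs the linear decrease:
    \<open>s\<^sup>2 / 2 - M * s\<close> is at least \<open>- M\<^sup>2 / 2\<close>, its value at
    \<open>s = M\<close>.\<close>
  have "G x - 1 - M * norm (w - x) - M\<^sup>2 / 2 \<le> \<phi> z" if "z \<in> D" for z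
  proof -
    have "norm (z - x) \<le> norm (z - w) + norm (w - x)"
      by (metis norm_triangle_ineq diff_add_cancel add_diff_eq)
    then have "M * norm (z - x) \<le> M * norm (z - w) + M * norm (w - x)"
      using M(1) by (metis distrib_left mult_left_mono)
    moreover have "0 \<le> (norm (z - w) - M)\<^sup>2" by simp
    then have "M * norm (z - w) \<le> 1 / 2 * (norm (z - w))\<^sup>2 + M\<^sup>2 / 2"
      by (simp add: power2_diff algebra_simps)
    ultimately show ?thesis using M(2)[OF that] unfolding \<phi>_def by linarith
  qed
  then have bdd: "bdd_below (\<phi> ` D)" by (intro bdd_belowI2)
  define m where "m = Inf (\<phi> ` D)"
  have m_le: "m \<le> \<phi> z" if "z \<in> D" for z
    unfolding m_def using that bdd by (intro cInf_lower) auto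
  have "\<exists>z\<in>D. \<phi> z < m + inverse (real (Suc n))" for n
    using cInf_lessD[of "\<phi> ` D" "m + inverse (real (Suc n))"] \<open>D \<noteq> {}\<close>
    unfolding m_def by auto
  then obtain s where s: "\<And>n. s n \<in> D" "\<And>n. \<phi> (s n) < m + inverse (real (Suc n))"
    by metis
  \<comment> \<open>At the midpoint \<open>\<phi>\<close> lies below the average of its end values
    by at least one eighth of the squared distance, yet it is still at least
    \<open>m\<close>.\<close>
  have mid: "(norm (p - q))\<^sup>2 \<le> 4 * (\<phi> p + \<phi> q - 2 * m)" if "p \<in> D" "q \<in> D" for p q
  proof -
    define c where "c = (1 - 1 / 2) *\<^sub>R p + (1 / 2) *\<^sub>R q"
    have "c \<in> D"
      unfolding c_def using that by (intro convexD_alt convex_on_imp_convex[OF conv]) auto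
    then have "m \<le> \<phi> c" by (rule m_le)
    moreover have "G c \<le> (1 - 1 / 2) * G p + 1 / 2 * G q"
      unfolding c_def using that by (intro convex_onD[OF conv]) auto
    moreover have "(norm (c - w))\<^sup>2
        = 1 / 2 * (norm (p - w))\<^sup>2 + 1 / 2 * (norm (q - w))\<^sup>2 - 1 / 4 * (norm (p - q))\<^sup>2"
      by (simp add: c_def power2_norm_eq_inner inner_simps inner_commute field_simps)
    ultimately show ?thesis unfolding \<phi>_def by argo
  qed
  have "Cauchy s"
  proof (rule metric_CauchyI)
    fix e :: real assume "0 < e"
    \<comment> \<open>Two values below \<open>m + e\<^sup>2 / 8\<close> make the bound in
      \<open>mid\<close> smaller than
      \<open>4 * (e\<^sup>2 / 8 + e\<^sup>2 / 8) = e\<^sup>2\<close>.\<close>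
    then obtain N where N: "inverse (real (Suc N)) < e\<^sup>2 / 8"
      using reals_Archimedean[of "e\<^sup>2 / 8"] by auto
    have small: "\<phi> (s n) < m + e\<^sup>2 / 8" if "N \<le> n" for n
    proof -
      have "inverse (real (Suc n)) \<le> inverse (real (Suc N))" using that by simp
      then show ?thesis using s(2)[of n] N by linarith
    qed
    have "dist (s i) (s j) < e" if "N \<le> i" "N \<le> j" for i j
    proof -
      have "(norm (s i - s j))\<^sup>2 < e\<^sup>2"
        using mid[OF s(1) s(1), of i j] small[OF that(1)] small[OF that(2)] by argo
      then show ?thesis using \<open>0 < e\<close> by (simp add: dist_norm power2_less_imp_less)
    qed
    then show "\<exists>N. \<forall>i\<ge>N. \<forall>j\<ge>N. dist (s i) (s j) < e" by blast
  qed
  then obtain p where p: "s \<longlonglongrightarrow> p" by (meson Cauchy_convergent convergentD)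
  \<comment> \<open>The available bound on \<open>G (s n)\<close> varies with \<open>n\<close>; the
    slack \<open>e\<close> yields one fixed sublevel set containing a tail of \<open>s\<close>, and
    its closedness passes to the limit.\<close>
  have sub: "p \<in> D \<and> G p \<le> m - 1 / 2 * (norm (p - w))\<^sup>2 + e" if "0 < e" for e
  proof -
    have "(\<lambda>n. m + inverse (real (Suc n)) - 1 / 2 * (norm (s n - w))\<^sup>2)
        \<longlonglongrightarrow> m + 0 - 1 / 2 * (norm (p - w))\<^sup>2"
      by (intro tendsto_intros p LIMSEQ_inverse_real_of_nat)
    then have "eventually (\<lambda>n. m + inverse (real (Suc n)) - 1 / 2 * (norm (s n - w))\<^sup>2
        < m - 1 / 2 * (norm (p - w))\<^sup>2 + e) sequentially"
      using that by (intro order_tendstoD) auto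
    then have "eventually (\<lambda>n. s n \<in> {z \<in> D. G z \<le> m - 1 / 2 * (norm (p - w))\<^sup>2 + e}) sequentially"
    proof eventually_elim
      case (elim n)
      then show ?case using s[of n] by (simp add: \<phi>_def)
    qed
    then have "p \<in> {z \<in> D. G z \<le> m - 1 / 2 * (norm (p - w))\<^sup>2 + e}"
      by (intro Lim_in_closed_set[OF closed _ _ p]) auto
    then show ?thesis by simp
  qed
  have "p \<in> D" using sub[of 1] by simp
  moreover have "\<phi> p \<le> m"
  proof (rule field_le_epsilon)
    fix e :: real assume "0 < e"
    from sub[OF this] show "\<phi> p \<le> m + e" by (simp add: \<phi>_def)
  qed
  ultimately show ?thesis using m_le unfolding \<phi>_def by force
qed

text \<open>Minimality is tested on the segment from \<open>p\<close> to \<open>z\<close>. The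
  quadratic term contributes its derivative at first order in the step \<open>t\<close>; dividing by
  \<open>t\<close> and letting \<open>t\<close> tend to 0 from the right removes the rest.\<close>

lemma proximal_variational_inequality:
  fixes G :: "'a::real_inner \<Rightarrow> real"
  assumes conv: "convex_on D G" and "p \<in> D" and "z \<in> D"
    and min: "\<And>z. z \<in> D \<Longrightarrow> G p + 1 / 2 * (norm (p - w))\<^sup>2 \<le> G z + 1 / 2 * (norm (z - w))\<^sup>2"
  shows "(w - p) \<bullet> (z - p) \<le> G z - G p"
proof -
  have ineq: "(w - p) \<bullet> (z - p) \<le> G z - G p + t / 2 * (norm (z - p))\<^sup>2" if t: "0 < t" "t < 1" for t
  proof -
    define q where "q = (1 - t) *\<^sub>R p + t *\<^sub>R z"
    have "q \<in> D"
      using convex_on_imp_convex[OF conv] \<open>p \<in> D\<close> \<open>z \<in> D\<close> t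
      by (auto simp: q_def convex_alt)
    then have "G p + 1 / 2 * (norm (p - w))\<^sup>2 \<le> G q + 1 / 2 * (norm (q - w))\<^sup>2" by (rule min)
    moreover have "G q \<le> (1 - t) * G p + t * G z"
      unfolding q_def using t \<open>p \<in> D\<close> \<open>z \<in> D\<close> by (intro convex_onD[OF conv]) auto
    moreover have "(norm (q - w))\<^sup>2
        = (norm (p - w))\<^sup>2 - 2 * t * ((w - p) \<bullet> (z - p)) + t\<^sup>2 * (norm (z - p))\<^sup>2"
      unfolding q_def power2_norm_eq_inner
      by (simp add: inner_simps inner_commute algebra_simps power2_eq_square)
    ultimately have "t * ((w - p) \<bullet> (z - p)) \<le> t * (G z - G p + t / 2 * (norm (z - p))\<^sup>2)"
      by (simp add: algebra_simps power2_eq_square)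
    then show ?thesis using t by simp
  qed
  have "((\<lambda>t. G z - G p + t / 2 * (norm (z - p))\<^sup>2) \<longlongrightarrow> G z - G p + 0 / 2 * (norm (z - p))\<^sup>2)
      (at_right 0)"
    by (intro tendsto_intros) auto
  moreover have "eventually (\<lambda>t. (w - p) \<bullet> (z - p) \<le> G z - G p + t / 2 * (norm (z - p))\<^sup>2) (at_right 0)"
    using eventually_at_right_real[of 0 1] by (rule eventually_mono) (use ineq in auto)
  ultimately show ?thesis
    using tendsto_lowerbound[of _ _ "at_right (0::real)"] by fastforce
qed

text \<open>Connects the extended-real \<open>prox\<close> with the two preceding results, applied
  to the real function \<open>c * g\<close> on the domain of \<open>g\<close>.\<close>

lemma prox_scaled:
  fixes g :: "'a::{real_inner, complete_space} \<Rightarrow> ereal" and w :: 'a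
  assumes "proper g" and "convex_fun g" and "lower_semicont g" and "0 < c"
  defines "p \<equiv> prox (\<lambda>z. ereal c * g z) w"
  shows "p \<in> eff_dom g"
    and "\<And>z. z \<in> eff_dom g \<Longrightarrow>
      (w - p) \<bullet> (z - p) \<le> c * (real_of_ereal (g z) - real_of_ereal (g p))"
proof -
  define G where "G z = c * real_of_ereal (g z)" for z
  define \<phi> where "\<phi> z = ereal c * g z + ereal (1 / 2 * (norm (z - w))\<^sup>2)" for z
  have conv: "convex_on (eff_dom g) G"
    unfolding G_def using convex_on_real_of_ereal[OF assms(1,2)] \<open>0 < c\<close>
    by (intro convex_on_cmul) auto
  have "{z \<in> eff_dom g. G z \<le> b} = {z \<in> eff_dom g. real_of_ereal (g z) \<le> b / c}" for b
    using \<open>0 < c\<close> by (auto simp: G_def field_simps)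
  then have closed: "closed {z \<in> eff_dom g. G z \<le> b}" for b
    using closed_sublevel_real_of_ereal[OF assms(1,3)] by simp
  have ne: "eff_dom g \<noteq> {}" using \<open>proper g\<close> by (simp add: proper_def)
  have \<phi>_dom: "\<phi> z = ereal (G z + 1 / 2 * (norm (z - w))\<^sup>2)" if "z \<in> eff_dom g" for z
    unfolding \<phi>_def G_def by (subst proper_eq_ereal[OF \<open>proper g\<close> that]) simp
  have \<phi>_out: "\<phi> z = \<infinity>" if "z \<notin> eff_dom g" for z
    using that \<open>0 < c\<close> by (simp add: \<phi>_def eff_dom_def)
  obtain q where "q \<in> eff_dom g"
    "\<forall>z\<in>eff_dom g. G q + 1 / 2 * (norm (q - w))\<^sup>2 \<le> G z + 1 / 2 * (norm (z - w))\<^sup>2"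
    using proximal_point_exists[OF conv ne closed] by blast
  then have "\<phi> q \<le> \<phi> z" for z
    by (cases "z \<in> eff_dom g") (auto simp: \<phi>_dom \<phi>_out)
  then have "is_arg_min \<phi> (\<lambda>_. True) q"
    by (simp add: is_arg_min_linorder)
  moreover have "p = arg_min \<phi> (\<lambda>_. True)"
    unfolding p_def prox_def \<phi>_def ..
  \<comment> \<open>\<open>arg_min\<close> is a choice operator, so it returns a minimizer once
    \<open>q\<close> shows that one exists.\<close>
  ultimately have "is_arg_min \<phi> (\<lambda>_. True) p"
    unfolding arg_min_def by (metis someI)
  then have min: "\<phi> p \<le> \<phi> z" for z
    by (simp add: is_arg_min_linorder)
  show dom: "p \<in> eff_dom g"
    using min[of q] \<phi>_out \<phi>_dom[OF \<open>q \<in> eff_dom g\<close>] by (cases "p \<in> eff_dom g") auto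
  fix z assume "z \<in> eff_dom g"
  have "G p + 1 / 2 * (norm (p - w))\<^sup>2 \<le> G v + 1 / 2 * (norm (v - w))\<^sup>2" if "v \<in> eff_dom g" for v
    using min[of v] unfolding \<phi>_dom[OF dom] \<phi>_dom[OF that] by simp
  then show "(w - p) \<bullet> (z - p) \<le> c * (real_of_ereal (g z) - real_of_ereal (g p))"
    using proximal_variational_inequality[OF conv dom \<open>z \<in> eff_dom g\<close>]
    by (simp add: G_def right_diff_distrib)
qed

section \<open>Gateaux gradients of convex functions\<close>

text \<open>Makes the definite description in \<open>gateaux_grad\<close> meaningful. Uniqueness of
  limits equates the inner products in every direction, and the direction \<open>u - v\<close> then
  gives the claim.\<close>

lemma has_gateaux_gradient_unique:
  assumes "has_gateaux_gradient h u x" and "has_gateaux_gradient h v x"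
  shows "u = v"
proof -
  have "ereal (d \<bullet> u) = ereal (d \<bullet> v)" for d
    using assms tendsto_unique[OF at_neq_bot] unfolding has_gateaux_gradient_def by blast
  then have "(u - v) \<bullet> (u - v) = 0" by (simp add: inner_diff_right)
  then show ?thesis by simp
qed

lemma has_gateaux_gradient_gateaux_grad:
  assumes "gateaux_differentiable h x"
  shows "has_gateaux_gradient h (gateaux_grad h x) x"
  using assms has_gateaux_gradient_unique unfolding gateaux_differentiable_def gateaux_grad_def
  by (metis theI)

text \<open>By convexity the difference quotients towards \<open>z\<close> with
  \<open>0 < t < 1\<close> stay below the slope of the full chord, so their limit from the right
  does too.\<close>

lemma convex_fun_gradient_inequality:
  assumes "proper h" and "convex_fun h" and grad: "has_gateaux_gradient h u x"
    and z: "z \<in> eff_dom h"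
  shows "(z - x) \<bullet> u \<le> real_of_ereal (h z) - real_of_ereal (h x)"
proof -
  note conv = convex_on_real_of_ereal[OF assms(1,2)]
  have x: "x \<in> eff_dom h"
    and lim: "((\<lambda>t. (h (x + t *\<^sub>R (z - x)) - h x) / ereal t) \<longlongrightarrow> ereal ((z - x) \<bullet> u)) (at 0)"
    using grad unfolding has_gateaux_gradient_def by auto
  have "(h (x + t *\<^sub>R (z - x)) - h x) / ereal t \<le> ereal (real_of_ereal (h z) - real_of_ereal (h x))"
    if t: "0 < t" "t < 1" for t
  proof -
    define q where "q = (1 - t) *\<^sub>R x + t *\<^sub>R z"
    have q: "q \<in> eff_dom h"
      using convex_on_imp_convex[OF conv] x z t by (auto simp: q_def convex_alt)
    have "real_of_ereal (h q) \<le> (1 - t) * real_of_ereal (h x) + t * real_of_ereal (h z)"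
      unfolding q_def using t x z by (intro convex_onD[OF conv]) auto
    then have "(real_of_ereal (h q) - real_of_ereal (h x)) / t
        \<le> real_of_ereal (h z) - real_of_ereal (h x)"
      using t by (simp add: field_simps)
    moreover have "(h q - h x) / ereal t = ereal ((real_of_ereal (h q) - real_of_ereal (h x)) / t)"
      using t
      by (subst proper_eq_ereal[OF \<open>proper h\<close> q], subst proper_eq_ereal[OF \<open>proper h\<close> x]) simp
    moreover have "x + t *\<^sub>R (z - x) = q" by (simp add: q_def algebra_simps)
    ultimately show ?thesis by simp
  qed
  then have "eventually (\<lambda>t. (h (x + t *\<^sub>R (z - x)) - h x) / ereal t
      \<le> ereal (real_of_ereal (h z) - real_of_ereal (h x))) (at_right 0)"
    using eventually_at_right_real[of 0 1] by (auto elim: eventually_mono)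
  moreover have "((\<lambda>t. (h (x + t *\<^sub>R (z - x)) - h x) / ereal t) \<longlongrightarrow> ereal ((z - x) \<bullet> u)) (at_right 0)"
    using lim by (rule filterlim_mono) (auto simp: at_le)
  ultimately have "ereal ((z - x) \<bullet> u) \<le> ereal (real_of_ereal (h z) - real_of_ereal (h x))"
    by (intro tendsto_upperbound[of _ _ "at_right (0::real)"]) auto
  then show ?thesis by simp
qed

section \<open>The inequalities for one relaxed forward-backward step\<close>

theorem proposition3p13:
  fixes f g :: "'a::{real_inner, complete_space} \<Rightarrow> ereal"
    and x y :: "nat \<Rightarrow> 'a"
    and \<gamma> lam :: "nat \<Rightarrow> real"
    and \<delta> :: real
    and k :: nat
  assumes "proper f" and "convex_fun f" and "lower_semicont f"
    and "proper g" and "convex_fun g" and "lower_semicont g"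
    and "eff_dom g \<subseteq> eff_dom f"
    and "\<forall>z\<in>eff_dom g. gateaux_differentiable f z"
    and "0 < \<gamma> k"
    and "0 < lam k" and "lam k \<le> 1"
    and "x k \<in> eff_dom g"
    and "y k = prox (\<lambda>z. ereal (\<gamma> k) * g z) (x k - \<gamma> k *\<^sub>R gateaux_grad f (x k))"
    and "x (Suc k) = x k + lam k *\<^sub>R (y k - x k)"
    and "0 < \<delta>" and "\<delta> < 1"
  shows
    "let F = (\<lambda>z. f z + g z);
         a = (norm (gateaux_grad f (x (Suc k)) - gateaux_grad f (x k))
                \<le> \<delta> / (\<gamma> k * lam k) * norm (x (Suc k) - x k));
         b = (f (x (Suc k)) - f (x k) - ereal ((x (Suc k) - x k) \<bullet> gateaux_grad f (x k))
                \<le> ereal (\<delta> / (\<gamma> k * lam k) * (norm (x (Suc k) - x k))\<^sup>2));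
         c = (F (x (Suc k)) - F (x k)
                \<le> ereal ((1 - \<delta>) * lam k)
                    * (g (y k) - g (x k) + ereal ((y k - x k) \<bullet> gateaux_grad f (x k))))
     in (a \<longrightarrow> b) \<and> (b \<longrightarrow> c)
      \<and> (c \<longrightarrow> (\<forall>z\<in>eff_dom g.
            ereal ((norm (x (Suc k) - z))\<^sup>2)
              \<le> ereal ((norm (x k - z))\<^sup>2)
                + ereal (2 * \<gamma> k * lam k) * (F z - F (x k))
                + ereal (2 * \<gamma> k / (1 - \<delta>)) * (F (x k) - F (x (Suc k)))
                - ereal ((norm (x (Suc k) - x k))\<^sup>2)))
      \<and> (c \<longrightarrow>
            ereal ((1 - \<delta>) * (norm (x (Suc k) - x k))\<^sup>2)
              \<le> ereal (\<gamma> k) * (F (x k) - F (x (Suc k)))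
            \<and> F (x (Suc k)) \<le> F (x k))"
proof -
  let ?x = "x k" and ?y = "y k" and ?x' = "x (Suc k)" and ?c = "\<gamma> k" and ?l = "lam k"
  let ?u = "gateaux_grad f (x k)" and ?u' = "gateaux_grad f (x (Suc k))"
  define fr where "fr z = real_of_ereal (f z)" for z
  define gr where "gr z = real_of_ereal (g z)" for z
  note x_Suc = \<open>x (Suc k) = x k + lam k *\<^sub>R (y k - x k)\<close>
  note \<gamma> = \<open>0 < \<gamma> k\<close> and \<lambda> = \<open>0 < lam k\<close> \<open>lam k \<le> 1\<close> and \<delta> = \<open>0 < \<delta>\<close> \<open>\<delta> < 1\<close>
  \<comment> \<open>Every point that occurs lies in \<open>eff_dom g\<close>, where \<open>f\<close>
    and \<open>g\<close> are finite. The claims are therefore proved over the reals and translated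
    back at the end.\<close>
  have f_eq: "f z = ereal (fr z)" if "z \<in> eff_dom g" for z
    unfolding fr_def using proper_eq_ereal[OF \<open>proper f\<close>] \<open>eff_dom g \<subseteq> eff_dom f\<close> that by blast
  have g_eq: "g z = ereal (gr z)" if "z \<in> eff_dom g" for z
    unfolding gr_def using proper_eq_ereal[OF \<open>proper g\<close> that] .
  have xd: "?x \<in> eff_dom g" by fact
  have yd: "?y \<in> eff_dom g"
    and prox: "\<And>z. z \<in> eff_dom g \<Longrightarrow> (?x - ?c *\<^sub>R ?u - ?y) \<bullet> (z - ?y) \<le> ?c * (gr z - gr ?y)"
    using prox_scaled[OF \<open>proper g\<close> \<open>convex_fun g\<close> \<open>lower_semicont g\<close> \<gamma>]
    unfolding \<open>y k = _\<close> gr_def by blast+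
  note conv = convex_on_real_of_ereal[OF \<open>proper g\<close> \<open>convex_fun g\<close>, folded gr_def]
  have x'_eq: "?x' = (1 - ?l) *\<^sub>R ?x + ?l *\<^sub>R ?y"
    unfolding x_Suc by (simp add: algebra_simps)
  have x'd: "?x' \<in> eff_dom g"
    unfolding x'_eq using convex_on_imp_convex[OF conv] xd yd \<lambda> by (auto simp: convex_alt)
  have g_x': "gr ?x' \<le> (1 - ?l) * gr ?x + ?l * gr ?y"
    unfolding x'_eq using \<lambda> xd yd by (intro convex_onD[OF conv]) auto
  have step: "?x' - ?x = ?l *\<^sub>R (?y - ?x)"
    unfolding x_Suc by simp
  have grad: "(w - z) \<bullet> gateaux_grad f z \<le> fr w - fr z"
    if "z \<in> eff_dom g" "w \<in> eff_dom g" for z w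
    unfolding fr_def using assms that
    by (intro convex_fun_gradient_inequality has_gateaux_gradient_gateaux_grad) auto
  define N where "N = (norm (?y - ?x))\<^sup>2"
  define \<Delta> where "\<Delta> = gr ?y - gr ?x + (?y - ?x) \<bullet> ?u"
  have N0: "0 \<le> N" by (simp add: N_def)
  have norm_step: "(norm (?x' - ?x))\<^sup>2 = ?l\<^sup>2 * N"
    unfolding step N_def using \<lambda> by (simp add: power_mult_distrib)
  have N_le: "N \<le> - ?c * \<Delta>"
    using prox[OF xd] unfolding N_def \<Delta>_def power2_norm_eq_inner
    by (simp add: inner_simps inner_commute algebra_simps)
  define Fr where "Fr z = fr z + gr z" for z
  \<comment> \<open>For \<open>a\<close> implies \<open>b\<close>, the gradient inequality is taken
    at the new point, which turns the left side into a gradient difference for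
    Cauchy-Schwarz.\<close>
  have "fr ?x' - fr ?x - (?x' - ?x) \<bullet> ?u \<le> \<delta> / (?c * ?l) * (norm (?x' - ?x))\<^sup>2"
    if a: "norm (?u' - ?u) \<le> \<delta> / (?c * ?l) * norm (?x' - ?x)"
  proof -
    have "fr ?x' - fr ?x - (?x' - ?x) \<bullet> ?u \<le> (?x' - ?x) \<bullet> (?u' - ?u)"
      using grad[OF x'd xd] by (simp add: inner_simps)
    also have "\<dots> \<le> norm (?x' - ?x) * norm (?u' - ?u)" by (rule norm_cauchy_schwarz)
    also have "\<dots> \<le> norm (?x' - ?x) * (\<delta> / (?c * ?l) * norm (?x' - ?x))"
      using a by (intro mult_left_mono) auto
    finally show ?thesis by (simp add: power2_eq_square mult_ac)
  qed
  \<comment> \<open>For \<open>b\<close> implies \<open>c\<close>, the linear part of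
    \<open>f\<close> and the convexity of \<open>g\<close> along the step contribute
    \<open>?l * \<Delta>\<close>, while \<open>N_le\<close> bounds the error in \<open>b\<close> by
    \<open>- \<delta> * ?l * \<Delta>\<close>.\<close>
  moreover have "Fr ?x' - Fr ?x \<le> (1 - \<delta>) * ?l * \<Delta>"
    if b: "fr ?x' - fr ?x - (?x' - ?x) \<bullet> ?u \<le> \<delta> / (?c * ?l) * (norm (?x' - ?x))\<^sup>2"
  proof -
    have "\<delta> / (?c * ?l) * (norm (?x' - ?x))\<^sup>2 = \<delta> * ?l / ?c * N"
      unfolding norm_step using \<lambda> by (simp add: power2_eq_square)
    also have "\<dots> \<le> \<delta> * ?l / ?c * (- ?c * \<Delta>)"
      using N_le \<delta> \<lambda> \<gamma> by (intro mult_left_mono) auto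
    also have "\<dots> = - \<delta> * ?l * \<Delta>" using \<gamma> by simp
    finally have "fr ?x' - fr ?x - ?l * ((?y - ?x) \<bullet> ?u) \<le> - \<delta> * ?l * \<Delta>"
      using b unfolding step by simp
    then show ?thesis using g_x' unfolding Fr_def \<Delta>_def by (simp add: algebra_simps)
  qed
  moreover have "(norm (?x' - z))\<^sup>2 \<le> (norm (?x - z))\<^sup>2 + 2 * ?c * ?l * (Fr z - Fr ?x)
        + 2 * ?c / (1 - \<delta>) * (Fr ?x - Fr ?x') - (norm (?x' - ?x))\<^sup>2"
    if c: "Fr ?x' - Fr ?x \<le> (1 - \<delta>) * ?l * \<Delta>" and z: "z \<in> eff_dom g" for z
  proof -
    have "(norm (?x' - z))\<^sup>2 = (norm (?x - z))\<^sup>2 + 2 * ?l * ((?y - ?x) \<bullet> (?x - z)) + ?l\<^sup>2 * N"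
      unfolding x_Suc N_def power2_norm_eq_inner
      by (simp add: inner_simps inner_commute algebra_simps power2_eq_square)
    \<comment> \<open>The variational inequality at \<open>z\<close> handles \<open>g\<close>, the
      gradient inequality at \<open>?x\<close> handles \<open>f\<close>; \<open>N\<close> arises
      from replacing \<open>?y - z\<close> by \<open>?x - z\<close>.\<close>
    moreover have "(?y - ?x) \<bullet> (?x - z) \<le> ?c * (Fr z - Fr ?x) - ?c * \<Delta> - N"
    proof -
      have "?c * ((z - ?x) \<bullet> ?u) \<le> ?c * (fr z - fr ?x)"
        using grad[OF xd z] \<gamma> by (intro mult_left_mono) auto
      then show ?thesis
        using prox[OF z] unfolding N_def \<Delta>_def Fr_def power2_norm_eq_inner
        by (simp add: inner_simps inner_commute algebra_simps)
    qed
    then have "2 * ?l * ((?y - ?x) \<bullet> (?x - z)) \<le> 2 * ?l * (?c * (Fr z - Fr ?x) - ?c * \<Delta> - N)"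
      using \<lambda> by (intro mult_left_mono) auto
    moreover have "- ?l * \<Delta> \<le> (Fr ?x - Fr ?x') / (1 - \<delta>)"
      using c \<delta> by (simp add: field_simps)
    then have "2 * ?c * (- ?l * \<Delta>) \<le> 2 * ?c * ((Fr ?x - Fr ?x') / (1 - \<delta>))"
      using \<gamma> by (intro mult_left_mono) auto
    \<comment> \<open>Used twice over, this turns the collected terms
      \<open>?l\<^sup>2 * N - 2 * ?l * N\<close> into at most \<open>- ?l\<^sup>2 * N\<close>, the
      negative squared step length of the claim.\<close>
    moreover have "?l\<^sup>2 * N \<le> ?l * N"
      using \<lambda> N0 by (intro mult_right_mono) (auto simp: power2_eq_square mult_left_le)
    ultimately show ?thesis unfolding norm_step by (simp add: algebra_simps)
  qed
  \<comment> \<open>The squared step length is at most \<open>?l * N\<close>, hence at most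
    \<open>- ?c * ?l * \<Delta>\<close> by \<open>N_le\<close>, and \<open>c\<close> converts
    \<open>\<Delta>\<close> into the decrease of \<open>Fr\<close>.\<close>
  moreover have "(1 - \<delta>) * (norm (?x' - ?x))\<^sup>2 \<le> ?c * (Fr ?x - Fr ?x')" "Fr ?x' \<le> Fr ?x"
    if c: "Fr ?x' - Fr ?x \<le> (1 - \<delta>) * ?l * \<Delta>"
  proof -
    have "(norm (?x' - ?x))\<^sup>2 \<le> ?l * N"
      unfolding norm_step using \<lambda> N0
      by (intro mult_right_mono) (auto simp: power2_eq_square mult_left_le)
    also have "\<dots> \<le> ?l * (- ?c * \<Delta>)" using N_le \<lambda> by (intro mult_left_mono) auto
    finally have "(1 - \<delta>) * (norm (?x' - ?x))\<^sup>2 \<le> (1 - \<delta>) * (?l * (- ?c * \<Delta>))"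
      using \<delta> by (intro mult_left_mono) auto
    also have "\<dots> = ?c * (- ((1 - \<delta>) * ?l * \<Delta>))" by (simp add: algebra_simps)
    also have "\<dots> \<le> ?c * (Fr ?x - Fr ?x')"
      using c \<gamma> by (intro mult_left_mono) auto
    finally show *: "(1 - \<delta>) * (norm (?x' - ?x))\<^sup>2 \<le> ?c * (Fr ?x - Fr ?x')" .
    have "0 \<le> (1 - \<delta>) * (norm (?x' - ?x))\<^sup>2" using \<delta> by simp
    with * have "0 \<le> ?c * (Fr ?x - Fr ?x')" by linarith
    then show "Fr ?x' \<le> Fr ?x" using \<gamma> by (simp add: zero_le_mult_iff)
  qed
  ultimately show ?thesis
    unfolding Let_def
    by (simp add: f_eq[OF xd] f_eq[OF x'd] g_eq[OF xd] g_eq[OF x'd] g_eq[OF yd]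
        f_eq g_eq Fr_def \<Delta>_def)
qed

end
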